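(* Let $D_1$ and $D_2$ be two vertex disjoint digraphs with Hamiltonian cycles $C_1=(x_0,x_1,\ldots,x_{n-1},x_0)$ and $C_2=(y_0,y_1,\ldots,y_{m-1},y_0)$, respectively, and let $D\in D_1\oplus D_2$. If $D$ is strong and contains no good pair (with respect to $C_1$ and $C_2$), then $D$ is vertex-pancyclic.
   Context: All paths and cycles are directed. Generalized sum: for pairwise vertex disjoint digraphs $D_1,\ldots,D_k$, $\oplus_{i=1}^k D_i$ is the set of all digraphs $D$ with $V(D)=\bigcup_i V(D_i)$, such that the subdigraph of $D$ induced by $V(D_i)$ is $D_i$ for each $i$, and such that between each pair of vertices lying in different $D_i$'s there is exactly one arc (in one direction). A digraph is strong if for any two distinct vertices $u,v$ there are a directed $uv$-path and a directed $vu$-path. A digraph $D$ of order $N\ge 3$ is vertex-pancyclic if for every vertex $v$ and every $\ell\in\{3,\ldots,N\}$, $D$ contains a directed cycle of length $\ell$ through $v$. Good pair: given two vertex disjoint cycles $C_1=(x_0,\ldots,x_{n-1},x_0)$ and $C_2=(y_0,\ldots,y_{m-1},y_0)$ in $D$, a good pair is a pair of arcs $x_s\to y_r$ and $y_{r-1}\to x_{s+1}$ of $D$ for some $s\in\{0,\ldots,n-1\}$, $r\in\{0,\ldots,m-1\}$ (subscripts modulo $n$ and $m$ respectively); $D$ "contains no good pair" means no such pair of arcs exists between $C_1$ and $C_2$. *)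

theory Defs
  imports "Graph_Theory.Graph_Theory"
begin

text \<open>
  Digraphs are finite, without loops and without parallel arcs; symmetric arcs (\<open>2\<close>-cycles)
  are allowed. This is the locale \<^locale>\<open>pair_digraph\<close>, where arcs are ordered pairs of vertices.
\<close>

text \<open>
  The cycle \<open>(x\<^sub>0, \<dots>, x\<^sub>n\<^sub>-\<^sub>1, x\<^sub>0)\<close> is given by the list \<open>[x\<^sub>0, \<dots>, x\<^sub>n\<^sub>-\<^sub>1]\<close>, whose length is
  therefore the length of the cycle. In a loopless digraph this forces length at least \<open>2\<close>.
\<close>

definition vcycle :: "'a pair_pre_digraph \<Rightarrow> 'a list \<Rightarrow> bool" where
  "vcycle D xs \<longleftrightarrow> pre_digraph.cycle (with_proj D) (vwalk_arcs (xs @ [hd xs]))"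

definition hamiltonian_cycle :: "'a pair_pre_digraph \<Rightarrow> 'a list \<Rightarrow> bool" where
  "hamiltonian_cycle D xs \<longleftrightarrow> vcycle D xs \<and> set xs = pverts D"

text \<open>
  The generalized sum of a list of digraphs. Pairwise disjointness of the vertex sets is not
  part of the definition; it has to be assumed where the sum is used.
\<close>

definition gen_sum :: "'a pair_pre_digraph list \<Rightarrow> 'a pair_pre_digraph set" where
  "gen_sum Ds = {D. pair_digraph D
     \<and> pverts D = (\<Union>i<length Ds. pverts (Ds ! i))
     \<and> (\<forall>i<length Ds. induced_subgraph (with_proj (Ds ! i)) (with_proj D))
     \<and> (\<forall>i<length Ds. \<forall>j<length Ds. i \<noteq> j \<longrightarrow>
          (\<forall>u\<in>pverts (Ds ! i). \<forall>v\<in>pverts (Ds ! j).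
             (u, v) \<in> parcs D \<longleftrightarrow> (v, u) \<notin> parcs D))}"

text \<open>
  The index \<open>r - 1\<close> modulo \<open>m\<close> is written \<open>(r + m - 1) mod m\<close> because subtraction on
  \<^typ>\<open>nat\<close> is truncated.
\<close>

definition has_good_pair :: "'a pair_pre_digraph \<Rightarrow> 'a list \<Rightarrow> 'a list \<Rightarrow> bool" where
  "has_good_pair D xs ys \<longleftrightarrow> (let n = length xs; m = length ys in
     \<exists>s<n. \<exists>r<m. (xs ! s, ys ! r) \<in> parcs D \<and>
       (ys ! ((r + m - 1) mod m), xs ! ((s + 1) mod n)) \<in> parcs D)"

definition vertex_pancyclic :: "'a pair_pre_digraph \<Rightarrow> bool" where
  "vertex_pancyclic D \<longleftrightarrow> 3 \<le> card (pverts D) \<and>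
     (\<forall>v\<in>pverts D. \<forall>l\<in>{3..card (pverts D)}. \<exists>xs. vcycle D xs \<and> length xs = l \<and> v \<in> set xs)"

end

theory Submission
  imports Defs
begin

text \<open>
  Index both cycles by the integers, modulo \<open>n\<close> and \<open>m\<close>. Without a good pair,
  \<open>x\<^sub>i \<rightarrow> y\<^sub>j\<close> implies \<open>x\<^sub>i\<^sub>+\<^sub>1 \<rightarrow> y\<^sub>j\<^sub>-\<^sub>1\<close>; going around the cycles, this is an equivalence, so whether
  \<open>x\<^sub>i \<rightarrow> y\<^sub>j\<close> depends only on \<open>i + j\<close>. This gives a predicate \<open>c\<close> on the integers with periods \<open>n\<close>
  and \<open>m\<close>, and \<open>c\<close> is not constant because \<open>D\<close> is strong.

  A segment of \<open>A\<close> consecutive \<open>x\<close>'s followed by one of \<open>B\<close> consecutive \<open>y\<close>'s can be closed to a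
  cycle, through any prescribed vertex, as soon as \<open>B - A\<close> is not a period of \<open>c\<close>. If \<open>2\<close> is not a
  period, then for every length \<open>3 \<le> l < n + m\<close> one of two consecutive choices of \<open>A\<close> works. If
  \<open>2\<close> is a period, then \<open>c\<close> alternates, \<open>n\<close> and \<open>m\<close> are even, and this settles all odd lengths.
  The remaining lengths are obtained from cycles \<open>X\<^sup>A Y\<^sup>q X Y\<^sup>E\<close> with four segments.
\<close>

section \<open>Cycles as vertex lists over a relation\<close>

definition closed_path :: "('a \<Rightarrow> 'a \<Rightarrow> bool) \<Rightarrow> 'a list \<Rightarrow> bool" where
  "closed_path R zs \<longleftrightarrow> zs \<noteq> [] \<and> distinct zs \<and> successively R (zs @ [hd zs])"

lemma pawalk_verts_vwalk_arcs:
  "length ws \<ge> 2 \<Longrightarrow> pawalk_verts u (vwalk_arcs ws) = ws"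
proof (induction ws arbitrary: u rule: vwalk_arcs.induct)
  case (3 x y xs)
  then show ?case by (cases xs) auto
qed auto

lemma pcas_vwalk_arcs:
  "length ws \<ge> 2 \<Longrightarrow> pcas u (vwalk_arcs ws) v \<longleftrightarrow> u = hd ws \<and> v = last ws"
proof (induction ws arbitrary: u rule: vwalk_arcs.induct)
  case (3 x y xs)
  show ?case using "3.IH"[of y] by (cases xs) auto
qed auto

lemma vwalk_arcs_subset_iff_successively:
  "set (vwalk_arcs ws) \<subseteq> S \<longleftrightarrow> successively (\<lambda>u v. (u, v) \<in> S) ws"
  by (induction ws rule: vwalk_arcs.induct) auto

lemma (in pair_wf_digraph) vcycle_iff_closed_path:
  "vcycle G zs \<longleftrightarrow> closed_path (\<lambda>u v. (u, v) \<in> parcs G) zs"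
proof (cases zs)
  case Nil
  then show ?thesis by (simp add: vcycle_def closed_path_def cycle_def)
next
  case (Cons z zs')
  let ?ws = "zs @ [hd zs]"
  have len: "length ?ws \<ge> 2" and ne: "vwalk_arcs ?ws \<noteq> []"
    using Cons by (auto simp: neq_Nil_conv)
  have hl: "hd ?ws = z" "last ?ws = z" using Cons by auto
  have "z \<in> pverts G" if "set (vwalk_arcs ?ws) \<subseteq> parcs G"
    using that Cons by (cases zs') (auto dest: in_arcsD1)
  \<comment> \<open>The library's distinctness condition omits the first vertex of the closed walk;
    what is left is a rotation of \<open>zs\<close>.\<close>
  moreover have "distinct (tl ?ws) \<longleftrightarrow> distinct zs" using Cons by auto
  ultimately show ?thesis
    unfolding vcycle_def closed_path_def cycle_def awalk_def
      pawalk_verts_vwalk_arcs[OF len] pcas_vwalk_arcs[OF len] hl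
      vwalk_arcs_subset_iff_successively[symmetric]
    using ne Cons by auto
qed

section \<open>Periodic predicates on the integers\<close>

lemma periodic_mult:
  fixes c :: "int \<Rightarrow> 'b"
  assumes "\<And>t. c (t + n) = c t"
  shows "c (t + k * n) = c t"
proof (induction k rule: int_induct[where k = 0])
  case (step1 i)
  then show ?case using assms[of "t + i * n"] by (simp add: algebra_simps)
next
  case (step2 i)
  then show ?case using assms[of "t + (i - 1) * n"] by (simp add: algebra_simps)
qed simp

lemma periodic_cong:
  fixes c :: "int \<Rightarrow> 'b"
  assumes "\<And>t. c (t + n) = c t" and "s mod n = t mod n"
  shows "c s = c t"
proof -
  obtain k where "s = t + n * k" using assms(2) by (metis mod_eqE)
  then show ?thesis using periodic_mult[of c n t k] assms(1) by (simp add: mult.commute)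
qed

text \<open>From \<open>t + d\<close>, another \<open>n - 1\<close> shifts by \<open>d\<close> lead
  to \<open>t + d * n\<close>, which is equivalent to \<open>t\<close> by periodicity; so the
  implication reverses.\<close>

lemma shift_invariant_if_shift_closed:
  fixes c :: "int \<Rightarrow> bool"
  assumes per: "\<And>t. c (t + n) = c t" and "n > 0" and step: "\<And>t. c t \<Longrightarrow> c (t + d)"
  shows "c (t + d) = c t"
proof
  have iter: "c (s + int k * d)" if "c s" for s k
  proof (induction k)
    case (Suc k)
    then show ?case using step[of "s + int k * d"] by (simp add: algebra_simps)
  qed (use that in simp)
  assume "c (t + d)"
  then have "c (t + d + int (nat (n - 1)) * d)" by (rule iter)
  then have "c (t + d * n)" using \<open>n > 0\<close> by (simp add: algebra_simps)
  then show "c t" using periodic_mult[of c n t d] per by blast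
qed (rule step)

lemma exists_descent:
  fixes c :: "int \<Rightarrow> bool"
  assumes "\<And>t. c (t + n) = c t" and "n > 0" and "c (s + d) \<noteq> c s"
  shows "\<exists>t. c t \<and> \<not> c (t + d)"
  using shift_invariant_if_shift_closed[of c n d s] assms by blast

text \<open>The step moves along an antidiagonal in one direction only, but \<open>n * m\<close>
  steps lead back to the same pair of residues, so every implication along it reverses.\<close>

lemma depends_on_sum:
  fixes f :: "int \<Rightarrow> int \<Rightarrow> bool"
  assumes per1: "\<And>i j. f (i + n) j = f i j" and per2: "\<And>i j. f i (j + m) = f i j"
    and "n > 0" and "m > 0" and step: "\<And>i j. f i j \<Longrightarrow> f (i + 1) (j - 1)"
  shows "f i j = f 0 (i + j)"
proof
  have iter: "f (a + k) (b - k)" if "f a b" "k \<ge> 0" for a b k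
    using that(2)
  proof (induction k rule: int_ge_induct)
    case (step k)
    then show ?case using assms(5)[of "a + k" "b - k"] by (simp add: algebra_simps)
  qed (use that in simp)
  have per: "f (a + k * (n * m)) (b - k * (n * m)) = f a b" for a b k
    using periodic_mult[of "\<lambda>i. f i (b - k * (n * m))" n a "k * m"]
      periodic_mult[of "f a" m b "- (k * n)"] per1 per2 by (simp add: algebra_simps)
  \<comment> \<open>Adding \<open>\<bar>i\<bar>\<close> full rounds of \<open>n * m\<close> steps
    keeps both step counts used below nonnegative, whatever the sign of \<open>i\<close>.\<close>
  have "\<bar>i\<bar> * 1 \<le> \<bar>i\<bar> * (n * m)"
    using \<open>n > 0\<close> \<open>m > 0\<close> by (intro mult_left_mono) (auto simp: int_one_le_iff_zero_less)
  then have le: "\<bar>i\<bar> \<le> \<bar>i\<bar> * (n * m)" by simp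
  show "f 0 (i + j)" if "f i j"
    using iter[OF that, of "\<bar>i\<bar> * (n * m) - i"] per[of 0 "\<bar>i\<bar>" "i + j"] le
    by (simp add: algebra_simps)
  show "f i j" if "f 0 (i + j)"
    using iter[OF that, of "\<bar>i\<bar> * (n * m) + i"] per[of i "\<bar>i\<bar>" j] le
    by (simp add: algebra_simps)
qed

section \<open>Cycles assembled from segments with integer indices\<close>

lemma hd_map_upto [simp]: "a \<le> b \<Longrightarrow> hd (map f [a..b]) = f a"
  by (simp add: upto_rec1)

lemma last_map_upto [simp]: "a \<le> b \<Longrightarrow> last (map f [a..b]) = f b"
  by (simp add: upto_rec2)

lemma successively_map_upto:
  assumes "\<And>i. R (f i) (f (i + 1))"
  shows "successively R (map f [a..b])"
proof (induction a b rule: upto.induct)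
  case (1 a b)
  then show ?case
    using assms[of a] by (cases "a < b"; cases "a = b") (auto simp: upto_rec1[of a] successively_Cons)
qed

text \<open>What remains of the digraph: \<open>c (i + j)\<close> decides the direction of the arc
  between \<open>X i\<close> and \<open>Y j\<close>, and \<open>ex_pos\<close>,
  \<open>ex_neg\<close> carry strong connectivity.\<close>

locale antidiagonal_cycles =
  fixes R :: "'a \<Rightarrow> 'a \<Rightarrow> bool" and X Y :: "int \<Rightarrow> 'a" and n m :: int and c :: "int \<Rightarrow> bool"
  assumes n_pos: "n > 0" and m_pos: "m > 0"
    and X_eq_iff: "X i = X j \<longleftrightarrow> i mod n = j mod n"
    and Y_eq_iff: "Y i = Y j \<longleftrightarrow> i mod m = j mod m"
    and X_neq_Y: "X i \<noteq> Y j"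
    and R_XX: "R (X i) (X (i + 1))" and R_YY: "R (Y j) (Y (j + 1))"
    and R_XY: "c (i + j) \<Longrightarrow> R (X i) (Y j)"
    and R_YX: "\<not> c (i + j) \<Longrightarrow> R (Y j) (X i)"
    and c_n: "c (t + n) = c t" and c_m: "c (t + m) = c t"
    and ex_pos: "\<exists>t. c t" and ex_neg: "\<exists>t. \<not> c t"
begin

lemma X_inj: "X i = X j \<Longrightarrow> \<bar>i - j\<bar> < n \<Longrightarrow> i = j"
  by (metis X_eq_iff mod_eq_dvd_iff dvd_imp_le_int right_minus_eq abs_of_pos n_pos
      linorder_not_less)

lemma Y_inj: "Y i = Y j \<Longrightarrow> \<bar>i - j\<bar> < m \<Longrightarrow> i = j"
  by (metis Y_eq_iff mod_eq_dvd_iff dvd_imp_le_int right_minus_eq abs_of_pos m_pos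
      linorder_not_less)

lemma not_invariant_one: "\<exists>t. c (t + 1) \<noteq> c t"
proof (rule ccontr)
  assume "\<not> ?thesis"
  then have "c (0 + t * 1) = c 0" for t by (intro periodic_mult) auto
  then have "c t \<longleftrightarrow> c 0" for t by simp
  then show False using ex_pos ex_neg by blast
qed

lemma n_ge_2: "n \<ge> 2"
  using not_invariant_one c_n n_pos by (cases "n = 1") auto

lemma m_ge_2: "m \<ge> 2"
  using not_invariant_one c_m m_pos by (cases "m = 1") auto

text \<open>Whether segments can be joined depends only on the sum of their starting indices. One
  index can therefore be spent on hitting \<open>v\<close>, and the other adjusts the sum.\<close>

lemma indices_with_sum:
  assumes "v \<in> range X \<union> range Y"
  shows "\<exists>i j. i + j = s \<and> (v = X i \<or> v = Y j)"
  using assms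
proof (elim UnE imageE)
  fix k assume "v = X k"
  then show ?thesis by (intro exI[of _ k] exI[of _ "s - k"]) simp
next
  fix k assume "v = Y k"
  then show ?thesis by (intro exI[of _ "s - k"] exI[of _ k]) simp
qed

lemma two_segment_closed_path:
  assumes A: "1 \<le> A" "A \<le> n" and B: "1 \<le> B" "B \<le> m"
    and c: "c t" "\<not> c (t + B - A)"
    and v: "v \<in> range X \<union> range Y"
  shows "\<exists>zs. closed_path R zs \<and> int (length zs) = A + B \<and> v \<in> set zs"
proof -
  \<comment> \<open>This sum gives the arc from the last \<open>X\<close> to the first
    \<open>Y\<close> index sum \<open>t\<close>; the returning arc then has index sum
    \<open>t + B - A\<close>.\<close>
  obtain i j where ij: "i + j = t - A + 1" and v: "v = X i \<or> v = Y j"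
    using indices_with_sum[OF v] by blast
  let ?xs = "map X [i..i + A - 1]" and ?ys = "map Y [j..j + B - 1]"
  have "i + A - 1 + j = t" "i + (j + B - 1) = t + B - A" using ij by simp_all
  then have "R (X (i + A - 1)) (Y j)" "R (Y (j + B - 1)) (X i)"
    using c by (simp_all only: R_XY R_YX not_False_eq_True)
  then have "successively R ((?xs @ ?ys) @ [X i])"
    unfolding successively_append_iff
    using A B by (auto simp: successively_map_upto R_XX R_YY)
  moreover have "distinct (?xs @ ?ys)"
    using A B X_inj Y_inj by (auto simp: distinct_map inj_on_def X_neq_Y)
  ultimately have "closed_path R (?xs @ ?ys)"
    using A by (simp add: closed_path_def)
  then show ?thesis
    using v A B by (intro exI[of _ "?xs @ ?ys"]) auto
qed

text \<open>The single vertex \<open>X (i + A)\<close> is inserted into a run of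
  \<open>q + E\<close> consecutive \<open>Y\<close>'s after the first \<open>q\<close>. The four
  assumptions on \<open>c\<close> are the index sums of the four connecting arcs, in cyclic
  order.\<close>

lemma four_segment_closed_path:
  assumes A: "1 \<le> A" "A + 1 \<le> n" and q: "1 \<le> q" and E: "1 \<le> E" "q + E \<le> m"
    and c: "c t" "\<not> c (t + q)" "c (t + q + 1)" "\<not> c (t + q + E - A)"
    and v: "v \<in> range X \<union> range Y"
  shows "\<exists>zs. closed_path R zs \<and> int (length zs) = A + q + 1 + E \<and> v \<in> set zs"
proof -
  obtain i j where ij: "i + j = t - A + 1" and v: "v = X i \<or> v = Y j"
    using indices_with_sum[OF v] by blast
  let ?zs = "map X [i..i + A - 1] @ map Y [j..j + q - 1] @ [X (i + A)]
    @ map Y [j + q..j + q + E - 1]"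
  have "i + A - 1 + j = t" "i + A + (j + q - 1) = t + q" "i + A + (j + q) = t + q + 1"
    "i + (j + q + E - 1) = t + q + E - A"
    using ij by simp_all
  then have "R (X (i + A - 1)) (Y j)" "R (Y (j + q - 1)) (X (i + A))"
    "R (X (i + A)) (Y (j + q))" "R (Y (j + q + E - 1)) (X i)"
    using c by (simp_all only: R_XY R_YX not_False_eq_True)
  then have "successively R (?zs @ [X i])"
    unfolding successively_append_iff
    using A q E by (auto simp: successively_map_upto R_XX R_YY)
  moreover have "distinct ?zs"
    using A q E X_inj Y_inj by (fastforce simp: distinct_map inj_on_def X_neq_Y X_neq_Y[symmetric])
  ultimately have "closed_path R ?zs"
    using A by (simp add: closed_path_def)
  then show ?thesis
    using v A q E by (intro exI[of _ ?zs]) auto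
qed

lemma closed_path_if_not_period:
  assumes "1 \<le> A" "A \<le> n" "1 \<le> B" "B \<le> m" and "c (s + (B - A)) \<noteq> c s"
    and "v \<in> range X \<union> range Y"
  shows "\<exists>zs. closed_path R zs \<and> int (length zs) = A + B \<and> v \<in> set zs"
proof -
  obtain t where "c t" "\<not> c (t + (B - A))"
    using exists_descent[of c n s "B - A"] c_n n_pos assms(5) by blast
  then show ?thesis
    using two_segment_closed_path[of A B t v] assms by (simp add: algebra_simps)
qed

lemma closed_path_alternating:
  assumes two: "\<And>t. c (t + 2) = c t"
    and l: "3 \<le> l" "l \<le> n + m" and v: "v \<in> range X \<union> range Y"
  shows "\<exists>zs. closed_path R zs \<and> int (length zs) = l \<and> v \<in> set zs"
proof -
  obtain s where s: "c (s + 1) \<noteq> c s" using not_invariant_one by blast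
  have c_eq: "c (t + k) = c t" if "even k" for t k
  proof (rule periodic_cong[of c 2, OF two])
    show "(t + k) mod 2 = t mod 2" using that by presburger
  qed
  have c_neq: "c (t + k) \<noteq> c t" if "odd k" for t k
  proof -
    have "c (t + k) = c (t + 1)"
      using c_eq[of "k - 1" "t + 1"] that by simp
    moreover have "c (t + 1) \<noteq> c t"
    proof (cases "even (t - s)")
      case True
      then show ?thesis using c_eq[of "t - s" s] c_eq[of "t - s" "s + 1"] s
        by (simp add: add.commute)
    next
      case False
      then show ?thesis using c_eq[of "t - s + 1" s] c_eq[of "t - s - 1" "s + 1"] s
        by (simp add: add.commute)
    qed
    ultimately show ?thesis by simp
  qed
  have nm: "even n" "even m"
    using c_neq[of n 0] c_neq[of m 0] c_n[of 0] c_m[of 0] by auto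
  show ?thesis
  proof (cases "even l")
    case False
    \<comment> \<open>The fewest \<open>X\<close>'s that leave at most \<open>m\<close>
      \<open>Y\<close>'s. As \<open>l\<close> is odd, so is the difference
      \<open>l - A - A\<close>.\<close>
    define A where "A = max 1 (l - m)"
    have "odd (l - A - A)" using False by simp
    then show ?thesis
      using closed_path_if_not_period[of A "l - A" s v] c_neq[of "l - A - A" s] l n_ge_2 m_ge_2 v
      by (auto simp: A_def)
  next
    case True
    \<comment> \<open>Here \<open>E = 1\<close>. Both \<open>n - 1\<close> and \<open>l - 3\<close>
      are odd, hence so are \<open>A\<close> and \<open>q\<close>; the bound \<open>l - 3\<close>
      ensures \<open>q \<ge> 1\<close>.\<close>
    define A where "A = min (n - 1) (l - 3)"
    define q where "q = l - 2 - A"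
    have A: "1 \<le> A" "A + 1 \<le> n" "odd A" and q: "1 \<le> q" "q + 1 \<le> m" "odd q"
      using l n_ge_2 m_ge_2 nm True by (auto simp: A_def q_def min_def)
    obtain t where t: "c t" using ex_pos by blast
    have "\<not> c (t + q)" using c_neq[of q t] q t by simp
    moreover have "c (t + q + 1)" using c_eq[of "q + 1" t] q t by (simp add: add.assoc)
    moreover have "\<not> c (t + q + 1 - A)"
      using c_neq[of "q + 1 - A" t] q A t by (simp add: algebra_simps)
    ultimately show ?thesis
      using four_segment_closed_path[of A q 1 t v] t A q v by (auto simp: q_def)
  qed
qed

text \<open>Two full segments never close up, since \<open>m - n\<close> is a period. Four segments
  with \<open>A = n - 1\<close> and \<open>E = m - q\<close> use all vertices, and modulo the
  periods the last condition on \<open>c\<close> becomes one at \<open>t + 1\<close>.\<close>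

lemma closed_path_spanning:
  assumes v: "v \<in> range X \<union> range Y"
  shows "\<exists>zs. closed_path R zs \<and> int (length zs) = n + m \<and> v \<in> set zs"
proof -
  obtain s where s: "c (s + 1) \<noteq> c s" using not_invariant_one by blast
  obtain t where t: "c t" "\<not> c (t + 1)"
    using exists_descent[of c n s 1] c_n n_pos s by blast
  obtain w where w: "c w" "\<not> c (w - 1)"
    using exists_descent[of c n "s + 1" "-1"] c_n n_pos s by auto
  \<comment> \<open>This places \<open>t + q\<close> at \<open>w - 1\<close> modulo
    \<open>m\<close>, where \<open>c\<close> rises from false to true as the inserted vertex
    requires.\<close>
  define q where "q = (w - 1 - t) mod m"
  have q: "0 \<le> q" "q < m" using m_pos by (auto simp: q_def)
  have "(t + q) mod m = (w - 1) mod m" by (simp add: q_def mod_simps)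
  then have *: "c (t + q + k) = c (w - 1 + k)" for k
    using c_m by (auto intro!: periodic_cong[of c m "t + q + k"] mod_add_cong)
  have "q \<noteq> 0" using *[of 0] t w by auto
  moreover have "c (t + q + (m - q) - (n - 1)) = c (t + 1)"
    using c_n[of "t + 1 - n"] c_m[of "t + 1 - n"] by (simp add: algebra_simps)
  ultimately show ?thesis
    using four_segment_closed_path[of "n - 1" q "m - q" t v] q t w *[of 0] *[of 1] n_ge_2 v
    by simp
qed

lemma closed_path_of_every_length:
  assumes l: "3 \<le> l" "l \<le> n + m" and v: "v \<in> range X \<union> range Y"
  shows "\<exists>zs. closed_path R zs \<and> int (length zs) = l \<and> v \<in> set zs"
proof (cases "\<forall>t. c (t + 2) = c t")
  case True
  then show ?thesis using closed_path_alternating l v by blast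
next
  case False
  then obtain s where s: "c (s + 2) \<noteq> c s" by blast
  show ?thesis
  proof (cases "l = n + m")
    case True
    then show ?thesis using closed_path_spanning v by simp
  next
    case neq: False
    define A where "A = max 1 (l - m)"
    have A: "1 \<le> A" "A + 1 \<le> n" "1 \<le> l - (A + 1)" "l - A \<le> m"
      using l n_ge_2 m_ge_2 neq by (auto simp: A_def)
    \<comment> \<open>Splitting with \<open>A\<close> or \<open>A + 1\<close> shifts
      \<open>?u\<close> to \<open>s + 2\<close> or \<open>s\<close>. As \<open>c\<close> differs
      there, one of the two values differs from \<open>c ?u\<close>.\<close>
    let ?u = "s + 2 - (l - A - A)"
    have "?u + (l - A - A) = s + 2" "?u + (l - (A + 1) - (A + 1)) = s" by simp_all
    then have "c (?u + (l - A - A)) \<noteq> c ?u \<or> c (?u + (l - (A + 1) - (A + 1))) \<noteq> c ?u"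
      using s by metis
    then show ?thesis
      using closed_path_if_not_period[of A "l - A" ?u v]
        closed_path_if_not_period[of "A + 1" "l - (A + 1)" ?u v] A v by auto
  qed
qed

end

section \<open>Integer indexing of the given cycles\<close>

definition cyclic_nth :: "'a list \<Rightarrow> int \<Rightarrow> 'a" where
  "cyclic_nth xs i = xs ! nat (i mod int (length xs))"

lemma cyclic_nth_eq_iff:
  assumes "distinct xs" and "xs \<noteq> []"
  shows "cyclic_nth xs i = cyclic_nth xs j \<longleftrightarrow> i mod int (length xs) = j mod int (length xs)"
  using assms by (simp add: cyclic_nth_def nth_eq_iff_index_eq nat_less_iff eq_nat_nat_iff)

lemma range_cyclic_nth:
  assumes "xs \<noteq> []"
  shows "range (cyclic_nth xs) = set xs"
proof
  show "range (cyclic_nth xs) \<subseteq> set xs"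
    using assms by (auto simp: cyclic_nth_def nat_less_iff)
  show "set xs \<subseteq> range (cyclic_nth xs)"
  proof
    fix x assume "x \<in> set xs"
    then obtain k where "k < length xs" "x = xs ! k" by (auto simp: in_set_conv_nth)
    then have "x = cyclic_nth xs (int k)" by (simp add: cyclic_nth_def)
    then show "x \<in> range (cyclic_nth xs)" by blast
  qed
qed

lemma cyclic_nth_add_length: "cyclic_nth xs (i + int (length xs)) = cyclic_nth xs i"
  by (simp add: cyclic_nth_def)

lemma successively_nth:
  "successively R xs \<Longrightarrow> Suc k < length xs \<Longrightarrow> R (xs ! k) (xs ! Suc k)"
proof (induction xs arbitrary: k rule: induct_list012)
  case (3 x y xs)
  then show ?case by (cases k) auto
qed auto

lemma closed_path_cyclic_nth:
  assumes "closed_path R xs"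
  shows "R (cyclic_nth xs i) (cyclic_nth xs (i + 1))"
proof -
  define k where "k = nat (i mod int (length xs))"
  have ne: "xs \<noteq> []" using assms by (simp add: closed_path_def)
  have k: "k < length xs" "int k = i mod int (length xs)"
    using ne by (auto simp: k_def nat_less_iff)
  have "nat ((i + 1) mod int (length xs)) = Suc k mod length xs"
  proof -
    have "(i + 1) mod int (length xs) = int (Suc k) mod int (length xs)"
      using k(2) by (simp add: mod_simps add.commute)
    then show ?thesis by (metis zmod_int nat_int)
  qed
  \<comment> \<open>The appended head supplies the wrap-around successor of the last entry.\<close>
  moreover have "(xs @ [hd xs]) ! Suc k = xs ! (Suc k mod length xs)"
    using k(1) ne by (cases "Suc k = length xs") (auto simp: nth_append hd_conv_nth)
  moreover have "R ((xs @ [hd xs]) ! k) ((xs @ [hd xs]) ! Suc k)"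
    using assms k(1) successively_nth[of R "xs @ [hd xs]" k] by (simp add: closed_path_def)
  ultimately show ?thesis
    using k(1) by (simp add: cyclic_nth_def k_def[symmetric] nth_append)
qed

lemma no_good_pair_cyclic_nth:
  assumes "\<not> has_good_pair D xs ys" and "xs \<noteq> []" and "ys \<noteq> []"
    and "(cyclic_nth xs i, cyclic_nth ys j) \<in> parcs D"
  shows "(cyclic_nth ys (j - 1), cyclic_nth xs (i + 1)) \<notin> parcs D"
proof -
  let ?n = "length xs" and ?m = "length ys"
  define s where "s = nat (i mod int ?n)"
  define r where "r = nat (j mod int ?m)"
  have s: "s < ?n" "int s = i mod int ?n" and r: "r < ?m" "int r = j mod int ?m"
    using assms by (auto simp: s_def r_def nat_less_iff)
  have "(i + 1) mod int ?n = int ((s + 1) mod ?n)"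
    using s(2) by (simp add: zmod_int mod_simps add.commute)
  moreover have "(j - 1) mod int ?m = int ((r + ?m - 1) mod ?m)"
  proof -
    \<comment> \<open>The summand \<open>?m\<close> prevents truncation at \<open>r = 0\<close> and
      vanishes modulo \<open>?m\<close>.\<close>
    have "int (r + ?m - 1) = int r - 1 + int ?m" using r(1) by simp
    then show ?thesis using r(2) by (simp add: zmod_int mod_simps)
  qed
  ultimately show ?thesis
    using assms(1,4) s(1) r(1)
    by (auto simp: has_good_pair_def Let_def cyclic_nth_def s_def[symmetric] r_def[symmetric])
qed

text \<open>Otherwise no arc leaves \<open>S\<close>, and everything reachable from \<open>u\<close>
  stays in \<open>S\<close>.\<close>

lemma strongly_connected_leaves_set:
  assumes "strongly_connected G" and "u \<in> S" and "u \<in> verts G" and "v \<in> verts G" and "v \<notin> S"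
  shows "\<exists>(a, b)\<in>arcs_ends G. a \<in> S \<and> b \<notin> S"
proof (rule ccontr)
  assume closed: "\<not> ?thesis"
  have "(u, v) \<in> (arcs_ends G)\<^sup>*"
    using assms by (auto simp: strongly_connected_def intro: reachable_rtranclI)
  then have "v \<in> S" by induction (use closed assms(2) in auto)
  then show False using assms(5) by blast
qed

section \<open>Transfer to the digraph\<close>

theorem theorem2:
  fixes D1 D2 D :: "'a pair_pre_digraph" and xs ys :: "'a list"
  assumes "pair_digraph D1" and "pair_digraph D2"
    and "pverts D1 \<inter> pverts D2 = {}"
    and "hamiltonian_cycle D1 xs" and "hamiltonian_cycle D2 ys"
    and "D \<in> gen_sum [D1, D2]"
    and "strongly_connected (with_proj D)"
    and "\<not> has_good_pair D xs ys"
  shows "vertex_pancyclic D"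
proof -
  interpret D1: pair_digraph D1 by fact
  interpret D2: pair_digraph D2 by fact
  interpret D: pair_digraph D using assms(6) by (simp add: gen_sum_def)
  let ?R = "\<lambda>u v. (u, v) \<in> parcs D"
  let ?X = "cyclic_nth xs" and ?Y = "cyclic_nth ys"
  let ?n = "int (length xs)" and ?m = "int (length ys)"
  have verts: "pverts D = pverts D1 \<union> pverts D2"
    using assms(6) by (auto simp: gen_sum_def lessThan_Suc)
  have "\<forall>i<length [D1, D2]. induced_subgraph (with_proj ([D1, D2] ! i)) (with_proj D)"
    using assms(6) by (simp add: gen_sum_def)
  from this[rule_format, of 0] this[rule_format, of 1]
  have "induced_subgraph (with_proj D1) (with_proj D)" "induced_subgraph (with_proj D2) (with_proj D)"
    by simp_all
  then have arcs: "parcs D1 \<subseteq> parcs D" "parcs D2 \<subseteq> parcs D"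
    unfolding induced_subgraph_def with_proj_simps by blast+
  have "\<forall>i<length [D1, D2]. \<forall>j<length [D1, D2]. i \<noteq> j \<longrightarrow>
      (\<forall>u\<in>pverts ([D1, D2] ! i). \<forall>v\<in>pverts ([D1, D2] ! j).
        (u, v) \<in> parcs D \<longleftrightarrow> (v, u) \<notin> parcs D)"
    using assms(6) unfolding gen_sum_def by blast
  from this[rule_format, of 0 1]
  have cross: "(u, v) \<in> parcs D \<longleftrightarrow> (v, u) \<notin> parcs D" if "u \<in> pverts D1" "v \<in> pverts D2" for u v
    using that by simp
  have cp: "closed_path (\<lambda>u v. (u, v) \<in> parcs D1) xs" "closed_path (\<lambda>u v. (u, v) \<in> parcs D2) ys"
    and sets: "set xs = pverts D1" "set ys = pverts D2"
    using assms(4,5) D1.vcycle_iff_closed_path D2.vcycle_iff_closed_path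
    by (auto simp: hamiltonian_cycle_def)
  have ne: "xs \<noteq> []" "ys \<noteq> []" and dist: "distinct xs" "distinct ys"
    using cp by (auto simp: closed_path_def)
  have ranges: "range ?X = pverts D1" "range ?Y = pverts D2"
    using range_cyclic_nth ne sets by auto
  then have mem: "?X i \<in> pverts D1" "?Y i \<in> pverts D2" for i by blast+
  define c where "c t \<longleftrightarrow> ?R (?X 0) (?Y t)" for t
  have XY: "?R (?X i) (?Y j) \<longleftrightarrow> c (i + j)" for i j
    unfolding c_def
  proof (rule depends_on_sum[where n = ?n and m = ?m])
    \<comment> \<open>The reverse arc would complete a good pair, and exactly one of the two
      directions is present.\<close>
    show "?R (?X (i + 1)) (?Y (j - 1))" if "?R (?X i) (?Y j)" for i j
      using no_good_pair_cyclic_nth[OF assms(8) ne that] cross[OF mem] by blast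
  qed (use ne in \<open>simp_all add: cyclic_nth_add_length\<close>)
  have YX: "?R (?Y j) (?X i) \<longleftrightarrow> \<not> c (i + j)" for i j
    using XY[of i j] cross[OF mem, of i j] by blast
  have X0: "?X 0 \<in> pverts D1" "?X 0 \<in> verts D" "?X 0 \<notin> pverts D2"
    and Y0: "?Y 0 \<in> pverts D2" "?Y 0 \<in> verts D" "?Y 0 \<notin> pverts D1"
    using mem verts assms(3) by auto
  interpret antidiagonal_cycles ?R ?X ?Y ?n ?m c
  proof
    show "?X i = ?X j \<longleftrightarrow> i mod ?n = j mod ?n" for i j
      using cyclic_nth_eq_iff dist ne by blast
    show "?Y i = ?Y j \<longleftrightarrow> i mod ?m = j mod ?m" for i j
      using cyclic_nth_eq_iff dist ne by blast
    show "?X i \<noteq> ?Y j" for i j using mem assms(3) by (metis disjoint_iff)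
    show "?R (?X i) (?X (i + 1))" for i using closed_path_cyclic_nth[OF cp(1), of i] arcs by blast
    show "?R (?Y i) (?Y (i + 1))" for i using closed_path_cyclic_nth[OF cp(2), of i] arcs by blast
    \<comment> \<open>Index \<open>?n\<close> denotes the same vertex as index \<open>0\<close>, so
      the pairs \<open>(?n, t)\<close> and \<open>(0, t)\<close> describe one arc.\<close>
    show "c (t + ?n) = c t" for t
      using XY[of ?n t] XY[of 0 t] cyclic_nth_add_length[of xs 0] by (simp add: add.commute)
    show "c (t + ?m) = c t" for t by (simp add: c_def cyclic_nth_add_length)
    \<comment> \<open>Strength forces an arc out of each side: one leaving \<open>D1\<close> makes
      \<open>c\<close> true somewhere, one leaving \<open>D2\<close> makes it false
      somewhere.\<close>
    obtain u v where uv: "?R u v" "u \<in> pverts D1" "v \<notin> pverts D1"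
      using strongly_connected_leaves_set[OF assms(7) X0(1,2) Y0(2,3)] by auto
    then have "v \<in> range ?Y" "u \<in> range ?X" using verts D.in_arcsD2 ranges by blast+
    then show "\<exists>t. c t" using uv(1) XY by auto
    obtain u v where uv: "?R u v" "u \<in> pverts D2" "v \<notin> pverts D2"
      using strongly_connected_leaves_set[OF assms(7) Y0(1,2) X0(2,3)] by auto
    then have "v \<in> range ?X" "u \<in> range ?Y" using verts D.in_arcsD2 ranges by blast+
    then show "\<exists>t. \<not> c t" using uv(1) YX by auto
  qed (use ne XY YX in auto)
  have "pverts D = set xs \<union> set ys" "set xs \<inter> set ys = {}"
    using verts sets assms(3) by simp_all
  then have card: "int (card (pverts D)) = ?n + ?m"
    using dist by (simp add: card_Un_disjoint distinct_card)
  show ?thesis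
    unfolding vertex_pancyclic_def
  proof (intro conjI ballI)
    show "3 \<le> card (pverts D)" using card n_ge_2 m_ge_2 by linarith
    fix v l assume "v \<in> pverts D" and "l \<in> {3..card (pverts D)}"
    then have "\<exists>zs. closed_path ?R zs \<and> int (length zs) = int l \<and> v \<in> set zs"
      using card verts ranges by (intro closed_path_of_every_length) auto
    then show "\<exists>zs. vcycle D zs \<and> length zs = l \<and> v \<in> set zs"
      using D.vcycle_iff_closed_path by auto
  qed
qed

end
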